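(* Let $C \subsetneq \mathbb{R}^d$ be a closed convex cone with $0 \in C$ and let $X \colon \Omega \to \mathbb{R}^d$ be a random variable. (a) For $w \in C^+\setminus\{0\}$, the function $p \mapsto Q^+_{X,w}(p)$ has convex values. In particular, $Q^+_{X,w}(p) \ominus H^+(w) = Q^+_{X,w}(p)$ for all $p \in [0,1]$. (b) The function $p \mapsto Q^+_{X,C}(p)$ has convex values. In particular, $Q^+_{X,C}(p) \ominus C = Q^+_{X,C}(p)$ for all $p \in [0,1]$.
   Context: $(\Omega,\mathcal{F},P)$ is a probability space; random variables $\Omega \to \mathbb{R}^d$ are Borel measurable maps. A cone is a set $C \subseteq \mathbb{R}^d$ with $sz \in C$ for all $s>0$, $z \in C$. The dual cone is $C^+ = \{w \in \mathbb{R}^d \mid w^Tz \geq 0 \text{ for all } z \in C\}$; for $w \in \mathbb{R}^d\setminus\{0\}$, $H^+(w) = \{z \mid w^Tz \geq 0\}$. For $w \in C^+\setminus\{0\}$ and $p \in [0,1]$, the upper $w$-quantile is $Q^+_{X,w}(p) = \{z \in \mathbb{R}^d \mid P(X \in z - \operatorname{int} H^+(w)) \leq p\} = \{z \in \mathbb{R}^d \mid P(w^TX < w^Tz) \leq p\}$, and the upper $C$-quantile is $Q^+_{X,C}(p) = \bigcap_{w \in C^+\setminus\{0\}} Q^+_{X,w}(p)$ (possibly empty). For sets $A,B \subseteq \mathbb{R}^d$, $A \ominus B = \operatorname{cl}(A - B)$ with $A - B = \{a - b \mid a \in A, b \in B\}$ and $\emptyset - B = \emptyset$. *)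

theory Defs
  imports "HOL-Probability.Probability"
begin

text \<open>
  \<open>\<real>\<^sup>d\<close> is \<^typ>\<open>real ^ 'd\<close>, and \<open>w\<^sup>T z\<close> is \<^term>\<open>w \<bullet> z\<close>.
\<close>

text \<open>
  Scaling by strictly positive factors only, in contrast to \<^const>\<open>cone\<close>: a nonempty
  set satisfying this predicate need not contain the origin.
\<close>
definition pos_cone :: "(real ^ 'd) set \<Rightarrow> bool" where
  "pos_cone C \<longleftrightarrow> (\<forall>s>0. \<forall>z\<in>C. s *\<^sub>R z \<in> C)"

definition dual_cone :: "(real ^ 'd) set \<Rightarrow> (real ^ 'd) set" where
  "dual_cone C = {w. \<forall>z\<in>C. w \<bullet> z \<ge> 0}"

definition pos_halfspace :: "real ^ 'd \<Rightarrow> (real ^ 'd) set" where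
  "pos_halfspace w = {z. w \<bullet> z \<ge> 0}"

text \<open>
  The elementwise difference \<open>{a - b | a \<in> A, b \<in> B}\<close>; the operator \<open>-\<close> on sets is the
  set-theoretic difference.
\<close>
definition set_sub :: "(real ^ 'd) set \<Rightarrow> (real ^ 'd) set \<Rightarrow> (real ^ 'd) set" where
  "set_sub A B = {a - b | a b. a \<in> A \<and> b \<in> B}"

definition cl_set_sub :: "(real ^ 'd) set \<Rightarrow> (real ^ 'd) set \<Rightarrow> (real ^ 'd) set"
    (infixl "\<ominus>" 65) where
  "A \<ominus> B = closure (set_sub A B)"

definition upper_w_quantile ::
    "'\<omega> measure \<Rightarrow> ('\<omega> \<Rightarrow> real ^ 'd) \<Rightarrow> real ^ 'd \<Rightarrow> real \<Rightarrow> (real ^ 'd) set" where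
  "upper_w_quantile M X w p =
     {z. \<P>(\<omega> in M. X \<omega> \<in> set_sub {z} (interior (pos_halfspace w))) \<le> p}"

lemma mem_set_sub_interior_pos_halfspace:
  assumes "w \<noteq> 0"
  shows "x \<in> set_sub {z} (interior (pos_halfspace w)) \<longleftrightarrow> w \<bullet> x < w \<bullet> z"
proof -
  have int: "interior (pos_halfspace w) = {h. w \<bullet> h > 0}"
    using assms by (simp add: pos_halfspace_def)
  have "x \<in> set_sub {z} (interior (pos_halfspace w)) \<longleftrightarrow> w \<bullet> (z - x) > 0"
    unfolding set_sub_def int by (auto intro!: exI[of _ "z - x"])
  then show ?thesis
    by (simp add: inner_diff_right)
qed

lemma upper_w_quantile_eq:
  assumes "w \<noteq> 0"
  shows "upper_w_quantile M X w p = {z. \<P>(\<omega> in M. w \<bullet> X \<omega> < w \<bullet> z) \<le> p}"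
  using assms by (simp add: upper_w_quantile_def mem_set_sub_interior_pos_halfspace)

definition upper_C_quantile ::
    "'\<omega> measure \<Rightarrow> ('\<omega> \<Rightarrow> real ^ 'd) \<Rightarrow> (real ^ 'd) set \<Rightarrow> real \<Rightarrow> (real ^ 'd) set" where
  "upper_C_quantile M X C p = (\<Inter>w \<in> dual_cone C - {0}. upper_w_quantile M X w p)"

end

theory Submission
  imports Defs
begin

text \<open>
  The set of \<open>t\<close> with \<open>P(w\<^sup>T X < t) \<le> p\<close> is a closed down-set of reals, as the strict
  distribution function is nondecreasing and left-continuous. Each \<open>w\<close>-quantile is its preimage
  under \<open>w\<^sup>T\<close>: closed, convex and stable under subtracting vectors on which \<open>w\<close> is
  nonnegative. These properties pass to intersections over the dual cone.
\<close>

lemma (in prob_space) prob_less_mono: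
  fixes Y :: "'a \<Rightarrow> real"
  assumes "Y \<in> borel_measurable M" and "s \<le> t"
  shows "\<P>(\<omega> in M. Y \<omega> < s) \<le> \<P>(\<omega> in M. Y \<omega> < t)"
  using assms by (intro finite_measure_mono) auto

text \<open>Left-continuity comes from continuity from below of the measure: the events where
  \<open>Y\<close> stays below thresholds increasing strictly to \<open>l\<close> exhaust the event
  \<open>Y \<omega> < l\<close>.\<close>

lemma (in prob_space) closed_prob_less_le:
  fixes Y :: "'a \<Rightarrow> real"
  assumes Y [measurable]: "Y \<in> borel_measurable M"
  shows "closed {t. \<P>(\<omega> in M. Y \<omega> < t) \<le> p}"
  unfolding closed_sequential_limits
proof (intro allI impI)
  fix x l
  assume "(\<forall>n. x n \<in> {t. \<P>(\<omega> in M. Y \<omega> < t) \<le> p}) \<and> x \<longlonglongrightarrow> l"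
  then have x: "\<And>n. \<P>(\<omega> in M. Y \<omega> < x n) \<le> p" and lim: "x \<longlonglongrightarrow> l"
    by auto
  \<comment> \<open>The events for \<open>x n\<close> itself need not be monotone in
    \<open>n\<close>. The thresholds \<open>l - 1 / real (Suc n)\<close> increase to
    \<open>l\<close>, and each is eventually exceeded by the sequence \<open>x\<close>.\<close>
  define A where "A n = {\<omega> \<in> space M. Y \<omega> < l - 1 / real (Suc n)}" for n
  have "incseq A"
  proof (rule incseq_SucI)
    fix n
    have "1 / real (Suc (Suc n)) \<le> 1 / real (Suc n)"
      by (simp add: frac_le)
    then show "A n \<subseteq> A (Suc n)"
      unfolding A_def by auto
  qed
  moreover have "range A \<subseteq> sets M"
    unfolding A_def by auto
  ultimately have "(\<lambda>n. prob (A n)) \<longlonglongrightarrow> prob (\<Union>n. A n)"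
    by (intro finite_Lim_measure_incseq)
  moreover have "(\<Union>n. A n) = {\<omega> \<in> space M. Y \<omega> < l}"
  proof (intro equalityI subsetI)
    fix \<omega> assume "\<omega> \<in> (\<Union>n. A n)"
    then obtain n where "\<omega> \<in> space M" "Y \<omega> < l - 1 / real (Suc n)"
      unfolding A_def by blast
    moreover have "1 / real (Suc n) > 0"
      by simp
    ultimately have "Y \<omega> < l"
      by linarith
    then show "\<omega> \<in> {\<omega> \<in> space M. Y \<omega> < l}"
      using \<open>\<omega> \<in> space M\<close> by simp
  next
    \<comment> \<open>The strict inequality leaves a positive gap \<open>l - Y \<omega>\<close>,
      into which some \<open>1 / real (Suc n)\<close> fits.\<close>
    fix \<omega> assume \<omega>: "\<omega> \<in> {\<omega> \<in> space M. Y \<omega> < l}"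
    then obtain n where "1 / real (Suc n) < l - Y \<omega>"
      using nat_approx_posE[of "l - Y \<omega>"] by auto
    then have "\<omega> \<in> A n"
      using \<omega> unfolding A_def by (simp del: of_nat_Suc)
    then show "\<omega> \<in> (\<Union>n. A n)"
      by blast
  qed
  \<comment> \<open>Some \<open>x m\<close> lies above the threshold of \<open>A n\<close>, so
    monotonicity passes the bound at \<open>x m\<close> down to \<open>A n\<close>.\<close>
  moreover have "prob (A n) \<le> p" for n
  proof -
    have "\<forall>\<^sub>F m in sequentially. l - 1 / real (Suc n) < x m"
      using lim by (rule order_tendstoD) simp
    then obtain m where "l - 1 / real (Suc n) \<le> x m"
      by (metis eventually_happens less_imp_le sequentially_bot)
    then show ?thesis
      unfolding A_def using prob_less_mono[OF Y] x order_trans by blast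
  qed
  ultimately show "l \<in> {t. \<P>(\<omega> in M. Y \<omega> < t) \<le> p}"
    using LIMSEQ_le_const2 by (metis (lifting) mem_Collect_eq)
qed

context prob_space
begin

context
  fixes X :: "'a \<Rightarrow> real ^ 'd" and w :: "real ^ 'd"
  assumes X [measurable]: "X \<in> borel_measurable M" and w: "w \<noteq> 0"
begin

lemma upper_w_quantile_eq_vimage:
  "upper_w_quantile M X w p = (\<bullet>) w -` {t. \<P>(\<omega> in M. w \<bullet> X \<omega> < t) \<le> p}"
  using w by (auto simp: upper_w_quantile_eq)

lemma closed_upper_w_quantile: "closed (upper_w_quantile M X w p)"
  unfolding upper_w_quantile_eq_vimage
  by (intro closed_vimage closed_prob_less_le continuous_intros) measurable

lemma convex_upper_w_quantile: "convex (upper_w_quantile M X w p)"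
proof -
  \<comment> \<open>A down-set contains every point below one of its members, hence everything
    between two of them.\<close>
  have "is_interval {t. \<P>(\<omega> in M. w \<bullet> X \<omega> < t) \<le> p}"
    unfolding is_interval_1
    using prob_less_mono[of "\<lambda>\<omega>. w \<bullet> X \<omega>"] by (auto intro: order_trans)
  then have "convex {t. \<P>(\<omega> in M. w \<bullet> X \<omega> < t) \<le> p}"
    by (rule is_interval_convex)
  then show ?thesis
    unfolding upper_w_quantile_eq_vimage
    by (intro convex_linear_vimage bounded_linear.linear bounded_linear_inner_right)
qed

text \<open>Subtracting \<open>c\<close> does not raise the threshold \<open>w \<bullet> z\<close>,
  so the event can only shrink. The condition on \<open>c\<close> covers both members of the
  half-space of \<open>w\<close> and members of a cone whose dual contains \<open>w\<close>.\<close>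

lemma upper_w_quantile_diff:
  assumes "z \<in> upper_w_quantile M X w p" and "w \<bullet> c \<ge> 0"
  shows "z - c \<in> upper_w_quantile M X w p"
proof -
  have "\<P>(\<omega> in M. w \<bullet> X \<omega> < w \<bullet> (z - c)) \<le> \<P>(\<omega> in M. w \<bullet> X \<omega> < w \<bullet> z)"
    using assms(2) by (intro prob_less_mono) (auto simp: inner_diff_right)
  then show ?thesis
    using assms(1) w by (auto simp: upper_w_quantile_eq)
qed

end

end

text \<open>Stability gives one inclusion, subtracting \<open>0\<close> gives the other, and the
  closure adds nothing. Parts (a) and (b) use it with \<open>B\<close> the half-space and the cone
  respectively.\<close>

lemma cl_set_sub_eq_self:
  assumes "closed A" and "0 \<in> B" and "\<And>a b. a \<in> A \<Longrightarrow> b \<in> B \<Longrightarrow> a - b \<in> A"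
  shows "A \<ominus> B = A"
proof -
  have "set_sub A B = A"
  proof
    show "set_sub A B \<subseteq> A"
      using assms(3) by (auto simp: set_sub_def)
    show "A \<subseteq> set_sub A B"
      using assms(2) by (force simp: set_sub_def)
  qed
  then show ?thesis
    using assms(1) by (simp add: cl_set_sub_def)
qed

theorem proposition3p8:
  fixes M :: "'\<omega> measure"
    and X :: "'\<omega> \<Rightarrow> real ^ 'd"
    and C :: "(real ^ 'd) set"
  assumes "prob_space M"
    and "X \<in> borel_measurable M"
    and "pos_cone C" and "convex C" and "closed C" and "0 \<in> C" and "C \<noteq> UNIV"
  shows "(\<forall>w \<in> dual_cone C - {0}.
            (\<forall>p \<in> {0..1}. convex (upper_w_quantile M X w p)) \<and>
            (\<forall>p \<in> {0..1}. upper_w_quantile M X w p \<ominus> pos_halfspace w = upper_w_quantile M X w p)) \<and>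
         (\<forall>p \<in> {0..1}. convex (upper_C_quantile M X C p)) \<and>
         (\<forall>p \<in> {0..1}. upper_C_quantile M X C p \<ominus> C = upper_C_quantile M X C p)"
proof -
  interpret prob_space M by fact
  note X = \<open>X \<in> borel_measurable M\<close>
  have "upper_w_quantile M X w p \<ominus> pos_halfspace w = upper_w_quantile M X w p"
    if "w \<noteq> 0" for w p
    using that X
    by (intro cl_set_sub_eq_self closed_upper_w_quantile upper_w_quantile_diff)
       (auto simp: pos_halfspace_def)
  moreover have "convex (upper_C_quantile M X C p)" for p
    unfolding upper_C_quantile_def using X by (intro convex_INT convex_upper_w_quantile) auto
  moreover have "upper_C_quantile M X C p \<ominus> C = upper_C_quantile M X C p" for p
  proof (rule cl_set_sub_eq_self)
    show "closed (upper_C_quantile M X C p)"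
      unfolding upper_C_quantile_def using X by (intro closed_INT ballI closed_upper_w_quantile) auto
    \<comment> \<open>Every \<open>w\<close> in the dual cone is nonnegative at \<open>c\<close>, so
      each intersected \<open>w\<close>-quantile keeps \<open>a - c\<close>.\<close>
    show "a - c \<in> upper_C_quantile M X C p" if "a \<in> upper_C_quantile M X C p" "c \<in> C" for a c
      using that upper_w_quantile_diff[OF X] by (auto simp: upper_C_quantile_def dual_cone_def)
  \<comment> \<open>The goal left over is \<open>0 \<in> C\<close>.\<close>
  qed fact
  ultimately show ?thesis
    using convex_upper_w_quantile[OF X] by blast
qed

end
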